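(* Let $p$ be a prime and let $(w_n)_{n\ge 1}$ be a sequence of positive integers. For each $n$, let $\overline{\mathbf{B}}_n$ be a uniform random element of the set $$\{B\in M_n(\mathbb{F}_p): B(i,j)=0\text{ for all } i,j\text{ such that } |i-j|>w_n\}.$$ The sequence of random variables $\dim\ker\overline{\mathbf{B}}_n$ is tight if and only if $$\liminf_{n\to\infty}\left(w_n-\log_p(n)\right)>-\infty.$$
   Context: $\ker\overline{\mathbf{B}}_n=\{v\in\mathbb{F}_p^n:\overline{\mathbf{B}}_nv=0\}$, and $\dim$ is dimension over $\mathbb{F}_p$. *)

theory Defs
  imports
    "HOL-Probability.Probability"
    "Jordan_Normal_Form.Matrix_Kernel"
    "Berlekamp_Zassenhaus.Finite_Field"
begin

text \<open>
  The field of \<open>p\<close> elements is \<open>'p mod_ring\<close> for a type \<open>'p\<close> of prime cardinality \<open>p = CARD('p)\<close>.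
  Matrix indices run from \<open>0\<close> to \<open>n - 1\<close>; the band condition depends only on the difference of the
  indices. It is stated over \<^typ>\<open>int\<close>, since subtraction on \<^typ>\<open>nat\<close> truncates.
\<close>

definition band_mats :: "nat \<Rightarrow> nat \<Rightarrow> 'a :: zero mat set" where
  "band_mats n w =
     {B \<in> carrier_mat n n. \<forall>i<n. \<forall>j<n. \<bar>int i - int j\<bar> > int w \<longrightarrow> B $$ (i, j) = 0}"

text \<open>\<^const>\<open>pmf_of_set\<close> is the uniform distribution only on finite nonempty sets.\<close>

lemma finite_band_mats: "finite (band_mats n w :: 'a :: {zero, finite} mat set)"
proof (rule finite_subset)
  show "(band_mats n w :: 'a mat set) \<subseteq>
          mat n n ` ({..<n} \<times> {..<n} \<rightarrow>\<^sub>E (UNIV :: 'a set))"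
  proof
    fix B :: "'a mat"
    assume "B \<in> band_mats n w"
    then have "B = mat n n (restrict (\<lambda>ij. B $$ ij) ({..<n} \<times> {..<n}))"
      by (intro eq_matI) (auto simp: band_mats_def)
    then show "B \<in> mat n n ` ({..<n} \<times> {..<n} \<rightarrow>\<^sub>E (UNIV :: 'a set))"
      by (rule image_eqI[where f = "mat n n"]) auto
  qed
  show "finite (mat n n ` ({..<n} \<times> {..<n} \<rightarrow>\<^sub>E (UNIV :: 'a set)))"
    by (intro finite_imageI finite_PiE) auto
qed

lemma band_mats_nonempty: "band_mats n w \<noteq> {}"
proof -
  have "0\<^sub>m n n \<in> band_mats n w"
    by (auto simp: band_mats_def)
  then show ?thesis
    by blast
qed

definition random_band_mat :: "nat \<Rightarrow> nat \<Rightarrow> 'p :: prime_card mod_ring mat pmf" where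
  "random_band_mat n w = pmf_of_set (band_mats n w)"

text \<open>
  The law on the real line of the dimension of the kernel, real-valued because
  \<^const>\<open>tight\<close> is a property of a sequence of measures on the reals.
\<close>

definition kernel_dim_law :: "'p :: prime_card mod_ring mat pmf \<Rightarrow> real measure" where
  "kernel_dim_law P = distr (measure_pmf P) borel (\<lambda>B. real (kernel_dim B))"

end

theory Submission
  imports Defs "Berlekamp_Zassenhaus.Berlekamp_Type_Based"
begin

text \<open>
  Let \<open>q\<close> be the size of the field and \<open>k\<^sub>b\<close> the number of kernel vectors supported on the first \<open>b\<close>
  coordinates.

  If \<open>w - log\<^sub>q n\<close> is bounded below, the expected size of the kernel is bounded, and Markov's
  inequality gives tightness. By character counting, this expectation is \<open>q ^ (-n)\<close> times the number of
  pairs \<open>(u, v)\<close> whose supports are more than \<open>w\<close> apart. Reading such a pair from left to right, each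
  change between nonzero entries of \<open>u\<close> and of \<open>v\<close> costs \<open>w\<close> forced zeros, so there are at most
  \<open>2 q ^ n (1 + q ^ (-w)) ^ n \<le> 2 q ^ n exp (n q ^ (-w))\<close> of them.

  Conversely, given the preceding columns, column \<open>b\<close> lies in their span with probability at least
  \<open>1 / (q ^ (w + 1) k\<^sub>b)\<close>, and then \<open>k\<^sub>b\<close> increases. Hence the expectation of \<open>min k\<^sub>b P\<close> grows in each step
  by at least \<open>1 / (P q ^ (w + 1))\<close> times the probability that the whole kernel has fewer than \<open>P\<close>
  elements. As it never exceeds \<open>P\<close>, that probability is at most \<open>P\<^sup>2 q ^ (w + 1) / n\<close>.
\<close>

unbundle no vec_syntax

section \<open>Kernel cardinality and fibre counting\<close>

text \<open>Coefficients with respect to a basis identify the kernel with a power of the field. This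
  links the dimension in the theorem to the cardinalities used in all counts.\<close>

lemma card_mat_kernel:
  fixes A :: "'a :: {field, finite} mat"
  assumes A: "A \<in> carrier_mat nr nc"
  shows "card (mat_kernel A) = CARD('a) ^ kernel_dim A"
proof -
  interpret kernel nr nc A
    using A by unfold_locales
  have fin: "finite (mat_kernel A)"
    by (rule finite_subset[OF mat_kernel_carrier[OF A]])
      (rule card_ge_0_finite, simp add: card_carrier_vec)
  \<comment> \<open>Being finite, the kernel is a finite spanning set of itself.\<close>
  have "Ker.fin_dim"
    unfolding Ker.fin_dim_def
    using fin Ker.in_own_span[of "mat_kernel A"] Ker.span_is_subset2[of "mat_kernel A"]
    by (intro exI[of _ "mat_kernel A"]) auto
  then obtain b where b: "finite b" "Ker.basis b"
    using Ker.finite_basis_exists by blast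
  then have bk: "b \<subseteq> mat_kernel A"
    by (simp add: Ker.basis_def)
  have uniq: "\<exists>!a. a \<in> b \<rightarrow>\<^sub>E UNIV \<and> Ker.lincomb a b = v" if "v \<in> mat_kernel A" for v
    using Ker.basis_criterion[OF b(1) bk] b(2) that by simp
  have "bij_betw (\<lambda>a. Ker.lincomb a b) (b \<rightarrow>\<^sub>E UNIV) (mat_kernel A)"
    unfolding bij_betw_def
  proof (intro conjI inj_onI equalityI subsetI)
    fix x y assume "x \<in> b \<rightarrow>\<^sub>E UNIV" "y \<in> b \<rightarrow>\<^sub>E UNIV" "Ker.lincomb x b = Ker.lincomb y b"
    moreover have "Ker.lincomb x b \<in> mat_kernel A"
      by (rule Ker.lincomb_closed) (use bk in auto)
    ultimately show "x = y"
      using uniq by metis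
  next
    fix v assume "v \<in> (\<lambda>a. Ker.lincomb a b) ` (b \<rightarrow>\<^sub>E UNIV)"
    then show "v \<in> mat_kernel A"
      using Ker.lincomb_closed[OF bk] by auto
  next
    fix v assume "v \<in> mat_kernel A"
    from uniq[OF this] show "v \<in> (\<lambda>a. Ker.lincomb a b) ` (b \<rightarrow>\<^sub>E UNIV)"
      by blast
  qed
  then have "card (mat_kernel A) = card (b \<rightarrow>\<^sub>E (UNIV :: 'a set))"
    by (metis bij_betw_same_card)
  also have "\<dots> = CARD('a) ^ card b"
    by (simp add: card_PiE b)
  finally show ?thesis
    using Ker.dim_basis[OF b] by simp
qed

lemma card_le_fibre_card_times:
  assumes "finite C" "f ` A \<subseteq> C" "\<And>y. y \<in> C \<Longrightarrow> card {x \<in> A. f x = y} \<le> m" "finite A"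
  shows "card A \<le> m * card C"
proof -
  have "card A = (\<Sum>y\<in>C. card {x \<in> A. f x = y})"
    using sum.group[OF assms(4,1,2), of "\<lambda>_. 1 :: nat"] by simp
  also have "\<dots> \<le> (\<Sum>y\<in>C. m)"
    by (intro sum_mono assms)
  finally show ?thesis
    by (simp add: mult.commute)
qed

subsection \<open>The span of the preceding columns\<close>

definition prefix_vecs :: "nat \<Rightarrow> nat \<Rightarrow> 'a :: zero vec set" where
  "prefix_vecs n b = {v \<in> carrier_vec n. \<forall>j<n. b \<le> j \<longrightarrow> v $ j = 0}"

lemma finite_prefix_vecs [simp]: "finite (prefix_vecs n b :: 'a :: {zero, finite} vec set)"
  by (rule finite_subset[OF _ finite_carrier_vec[of n]]) (auto simp: prefix_vecs_def)

text \<open>The minimum matters because the space is also used with the bound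
  \<open>b + w + 1\<close>, which may exceed \<open>n\<close>.\<close>

lemma card_prefix_vecs:
  "card (prefix_vecs n b :: 'a :: {zero, finite} vec set) = CARD('a) ^ min b n"
proof -
  have "bij_betw (\<lambda>v. vec n (\<lambda>i. if i < b then v $ i else 0))
          (carrier_vec (min b n)) (prefix_vecs n b :: 'a vec set)"
    by (rule bij_betw_byWitness[where f' = "\<lambda>v. vec (min b n) (\<lambda>i. v $ i)"])
      (auto simp: prefix_vecs_def intro!: eq_vecI)
  from bij_betw_same_card[OF this] show ?thesis
    by (simp add: card_carrier_vec)
qed

lemma prefix_vecs_diff:
  fixes u v :: "'a :: ab_group_add vec"
  assumes "u \<in> prefix_vecs n b" "v \<in> prefix_vecs n b"
  shows "u - v \<in> prefix_vecs n b"
  using assms by (auto simp: prefix_vecs_def)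

text \<open>The possible values of column \<open>b\<close> of a band matrix, whatever its other
  columns are.\<close>

definition window_vecs :: "nat \<Rightarrow> nat \<Rightarrow> nat \<Rightarrow> 'a :: zero vec set" where
  "window_vecs n w b = {c \<in> carrier_vec n. \<forall>i<n. \<bar>int i - int b\<bar> > int w \<longrightarrow> c $ i = 0}"

lemma finite_window_vecs [simp]: "finite (window_vecs n w b :: 'a :: {zero, finite} vec set)"
  by (rule finite_subset[OF _ finite_carrier_vec[of n]]) (auto simp: window_vecs_def)

lemma window_vecs_diff:
  fixes u v :: "'a :: ab_group_add vec"
  assumes "u \<in> window_vecs n w b" "v \<in> window_vecs n w b"
  shows "u - v \<in> window_vecs n w b"
  using assms by (auto simp: window_vecs_def)

text \<open>A column \<open>j < b\<close> vanishes below row \<open>j + w\<close>, hence from row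
  \<open>b + w\<close> on.\<close>

lemma band_mult_prefix_vec:
  fixes B :: "'a :: field mat"
  assumes B: "B \<in> band_mats n w" and v: "v \<in> prefix_vecs n b"
  shows "B *\<^sub>v v \<in> prefix_vecs n (b + w)"
proof -
  have "(\<Sum>j<n. B $$ (i, j) * v $ j) = 0" if "i < n" "b + w \<le> i" for i
  proof (rule sum.neutral, safe)
    fix j assume "j < n"
    then show "B $$ (i, j) * v $ j = 0"
      using B v that by (cases "b \<le> j") (auto simp: band_mats_def prefix_vecs_def)
  qed
  then show ?thesis
    using B v by (auto simp: prefix_vecs_def band_mats_def scalar_prod_def atLeast0LessThan)
qed

text \<open>The linear relations among the first \<open>b\<close> columns; later columns have no
  influence on this set. Its cardinality is the number \<open>k\<^sub>b\<close> above.\<close>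

definition kernel_prefix :: "nat \<Rightarrow> 'a :: field mat \<Rightarrow> 'a vec set" where
  "kernel_prefix b B = mat_kernel B \<inter> prefix_vecs (dim_col B) b"

lemma finite_kernel_prefix [simp]: "finite (kernel_prefix b (B :: 'a :: {field, finite} mat))"
  by (simp add: kernel_prefix_def)

text \<open>Both the window of column \<open>b\<close> and the span of the preceding columns lie in the space of
  vectors supported on the first \<open>b + w + 1\<close> coordinates. The span contains
  \<open>q ^ b / card (kernel_prefix b B)\<close> of the \<open>q ^ (b + w + 1)\<close> vectors of that space.\<close>

lemma card_window_vecs_in_span:
  fixes B :: "'a :: {field, finite} mat"
  assumes B: "B \<in> band_mats n w" and b: "b < n"
  defines "G \<equiv> {c \<in> window_vecs n w b. \<exists>v \<in> prefix_vecs n b. B *\<^sub>v v = c}"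
  shows "card (window_vecs n w b :: 'a vec set)
           \<le> card G * card (kernel_prefix b B) * CARD('a) ^ (w + 1)"
proof -
  let ?q = "CARD('a)" and ?W = "window_vecs n w b :: 'a vec set"
  let ?V = "prefix_vecs n b :: 'a vec set"
  have Bc: "B \<in> carrier_mat n n"
    using B by (auto simp: band_mats_def)
  note mult_diff = mult_minus_distrib_mat_vec[OF Bc]
  \<comment> \<open>\<open>Z\<close> is the kernel of the linear map sending \<open>(v, c)\<close>
    to \<open>B *\<^sub>v v - c\<close>. The size of the target space bounds \<open>card Z\<close>
    from below, the projection to \<open>c\<close> from above.\<close>
  define Z where "Z = {vc \<in> ?V \<times> ?W. B *\<^sub>v fst vc = snd vc}"
  have finZ: "finite Z" and finG: "finite G"
    by (auto simp: Z_def G_def intro: finite_subset[of _ "?V \<times> ?W"])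
  have "card (?V \<times> ?W) \<le> card Z * card (prefix_vecs n (b + w + 1) :: 'a vec set)"
  proof (rule card_le_fibre_card_times[where f = "\<lambda>vc. B *\<^sub>v fst vc - snd vc"])
    show "(\<lambda>vc. B *\<^sub>v fst vc - snd vc) ` (?V \<times> ?W) \<subseteq> prefix_vecs n (b + w + 1)"
    proof safe
      fix v c assume "v \<in> ?V" "c \<in> ?W"
      then show "B *\<^sub>v fst (v, c) - snd (v, c) \<in> prefix_vecs n (b + w + 1)"
        using band_mult_prefix_vec[OF B \<open>v \<in> ?V\<close>]
        by (auto simp: prefix_vecs_def window_vecs_def)
    qed
  next
    fix y :: "'a vec" assume "y \<in> prefix_vecs n (b + w + 1)"
    let ?S = "{x \<in> ?V \<times> ?W. B *\<^sub>v fst x - snd x = y}"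
    show "card ?S \<le> card Z"
    proof (cases "?S = {}")
      case False
      \<comment> \<open>Translating by one point of the fibre embeds the fibre into
        \<open>Z\<close>.\<close>
      then obtain v0 c0 where 0: "v0 \<in> ?V" "c0 \<in> ?W" "B *\<^sub>v v0 - c0 = y"
        by auto
      have carr: "v0 \<in> carrier_vec n" "c0 \<in> carrier_vec n" "B *\<^sub>v v0 \<in> carrier_vec n"
        using 0 Bc by (auto simp: prefix_vecs_def window_vecs_def)
      show ?thesis
      proof (rule card_inj_on_le[where f = "\<lambda>(v, c). (v - v0, c - c0)"])
        show "inj_on (\<lambda>(v, c). (v - v0, c - c0)) ?S"
        proof (rule inj_onI, clarsimp)
          fix v c v' c'
          assume m: "v \<in> ?V" "v' \<in> ?V" "c \<in> ?W" "c' \<in> ?W"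
            and e: "v - v0 = v' - v0" "c - c0 = c' - c0"
          have "v $ i = v' $ i" "c $ i = c' $ i" if "i < n" for i
            using arg_cong[OF e(1), of "\<lambda>u. u $ i"] arg_cong[OF e(2), of "\<lambda>u. u $ i"] carr that
            by auto
          then show "v = v' \<and> c = c'"
            using m by (auto simp: prefix_vecs_def window_vecs_def)
        qed
        show "(\<lambda>(v, c). (v - v0, c - c0)) ` ?S \<subseteq> Z"
        proof (rule image_subsetI)
          fix x assume "x \<in> ?S"
          then obtain v c where x: "x = (v, c)" and m: "v \<in> ?V" "c \<in> ?W" and e: "B *\<^sub>v v - c = y"
            by (cases x) auto
          have carr': "v \<in> carrier_vec n" "c \<in> carrier_vec n" "B *\<^sub>v v \<in> carrier_vec n"
            using m Bc by (auto simp: prefix_vecs_def window_vecs_def)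
          have "B *\<^sub>v v - B *\<^sub>v v0 = c - c0"
          proof (rule eq_vecI)
            fix i assume "i < dim_vec (c - c0)"
            then have i: "i < n"
              using carr by simp
            have "(B *\<^sub>v v - c) $ i = (B *\<^sub>v v0 - c0) $ i"
              using e 0 by simp
            then show "(B *\<^sub>v v - B *\<^sub>v v0) $ i = (c - c0) $ i"
              using carr carr' i Bc by (simp add: algebra_simps)
          qed (use carr carr' Bc in auto)
          then show "(case x of (v, c) \<Rightarrow> (v - v0, c - c0)) \<in> Z"
            using m 0 carr carr' by (simp add: x Z_def mult_diff prefix_vecs_diff window_vecs_diff)
        qed
      qed (rule finZ)
    next
      case True
      then show ?thesis
        by (simp only: card.empty)
    qed
  qed simp_all
  then have "?q ^ b * card ?W \<le> card Z * ?q ^ min (b + w + 1) n"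
    using b by (simp add: card_prefix_vecs card_cartesian_product)
  also have "\<dots> \<le> card Z * ?q ^ (b + w + 1)"
    by (intro mult_left_mono power_increasing) auto
  finally have "?q ^ b * card ?W \<le> ?q ^ b * (card Z * ?q ^ (w + 1))"
    by (simp add: power_add mult_ac)
  then have 1: "card ?W \<le> card Z * ?q ^ (w + 1)"
    by simp
  \<comment> \<open>Two vectors of \<open>?V\<close> with the same image under \<open>B\<close>
    differ by an element of \<open>kernel_prefix b B\<close>.\<close>
  have "card Z \<le> card (kernel_prefix b B) * card G"
  proof (rule card_le_fibre_card_times[where f = snd])
    fix y assume "y \<in> G"
    then obtain v0 where v0: "v0 \<in> ?V" "B *\<^sub>v v0 = y"
      by (auto simp: G_def)
    show "card {x \<in> Z. snd x = y} \<le> card (kernel_prefix b B)"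
    proof (rule card_inj_on_le[where f = "\<lambda>x. fst x - v0"])
      show "inj_on (\<lambda>x. fst x - v0) {x \<in> Z. snd x = y}"
      proof (rule inj_onI)
        fix x x' assume x: "x \<in> {x \<in> Z. snd x = y}" "x' \<in> {x \<in> Z. snd x = y}"
          and e: "fst x - v0 = fst x' - v0"
        have m: "fst x \<in> ?V" "fst x' \<in> ?V"
          using x by (auto simp: Z_def)
        have "fst x $ i = fst x' $ i" if "i < n" for i
          using arg_cong[OF e, of "\<lambda>u. u $ i"] v0 that by (auto simp: prefix_vecs_def)
        then have "fst x = fst x'"
          using m by (auto simp: prefix_vecs_def)
        then show "x = x'"
          using x by (simp add: prod_eq_iff)
      qed
      show "(\<lambda>x. fst x - v0) ` {x \<in> Z. snd x = y} \<subseteq> kernel_prefix b B"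
      proof (rule image_subsetI)
        fix x assume "x \<in> {x \<in> Z. snd x = y}"
        then have v: "fst x \<in> ?V" "B *\<^sub>v fst x = y"
          by (auto simp: Z_def)
        have carr: "fst x \<in> carrier_vec n" "v0 \<in> carrier_vec n" "y \<in> carrier_vec n"
          using v v0 Bc by (auto simp: prefix_vecs_def)
        then have "B *\<^sub>v (fst x - v0) = 0\<^sub>v n"
          by (simp add: mult_diff v v0)
        then show "fst x - v0 \<in> kernel_prefix b B"
          using prefix_vecs_diff[OF v(1) v0(1)] Bc carr
          by (simp add: kernel_prefix_def mat_kernel[OF Bc])
      qed
    qed simp
  next
    show "snd ` Z \<subseteq> G"
      by (auto simp: Z_def G_def)
  qed (simp_all add: finZ finG)
  then have "card Z * ?q ^ (w + 1) \<le> card G * card (kernel_prefix b B) * ?q ^ (w + 1)"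
    by (simp add: mult_ac)
  with 1 show ?thesis
    by (rule order_trans)
qed

subsection \<open>Resampling a column\<close>

definition set_col :: "nat \<Rightarrow> 'a vec \<Rightarrow> 'a mat \<Rightarrow> 'a mat" where
  "set_col b c B = mat (dim_row B) (dim_col B) (\<lambda>(i, j). if j = b then c $ i else B $$ (i, j))"

lemma set_col_in_band:
  "B \<in> band_mats n w \<Longrightarrow> c \<in> window_vecs n w b \<Longrightarrow> set_col b c B \<in> band_mats n w"
  by (auto simp: set_col_def band_mats_def window_vecs_def)

text \<open>Exchanging column \<open>b\<close> with the separate vector \<open>c\<close> is an
  involution on the pairs \<open>(B, c)\<close>. Hence resampling a column preserves the uniform
  distribution.\<close>

lemma sum_set_col:
  fixes F :: "'a :: {field, finite} mat \<Rightarrow> nat"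
  assumes b: "b < n"
  shows "(\<Sum>B\<in>band_mats n w. \<Sum>c\<in>window_vecs n w b. F (set_col b c B))
           = card (window_vecs n w b :: 'a vec set) * (\<Sum>B\<in>band_mats n w. F B)"
proof -
  let ?S = "(band_mats n w :: 'a mat set) \<times> (window_vecs n w b :: 'a vec set)"
  let ?g = "\<lambda>(B, c). (set_col b c B, col B b) :: 'a mat \<times> 'a vec"
  have bij: "bij_betw ?g ?S ?S"
  proof (rule bij_betw_byWitness[where f' = ?g])
    have inv: "?g (?g x) = x" and cl: "?g x \<in> ?S" if xS: "x \<in> ?S" for x
    proof -
      obtain B c where x: "x = (B, c)" and m: "B \<in> band_mats n w" "c \<in> window_vecs n w b"
        using xS by (cases x) auto
      have B: "B \<in> carrier_mat n n" and c: "c \<in> carrier_vec n"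
        using m by (auto simp: band_mats_def window_vecs_def)
      have "set_col b (col B b) (set_col b c B) = B"
        using B b by (auto simp: set_col_def)
      moreover have "col (set_col b c B) b = c"
        using B b c by (auto simp: set_col_def)
      ultimately show "?g (?g x) = x"
        by (simp add: x)
      have "col B b \<in> window_vecs n w b"
        using m b by (auto simp: band_mats_def window_vecs_def)
      then show "?g x \<in> ?S"
        using set_col_in_band[OF m] by (simp add: x)
    qed
    show "\<forall>x\<in>?S. ?g (?g x) = x" "\<forall>x\<in>?S. ?g (?g x) = x" "?g ` ?S \<subseteq> ?S" "?g ` ?S \<subseteq> ?S"
      using inv cl by blast+
  qed
  have "(\<Sum>B\<in>band_mats n w. \<Sum>c\<in>window_vecs n w b. F (set_col b c B)) = (\<Sum>x\<in>?S. F (fst (?g x)))"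
    by (simp add: sum.cartesian_product case_prod_beta)
  also have "\<dots> = (\<Sum>x\<in>?S. F (fst x))"
    by (rule sum.reindex_bij_betw[OF bij])
  also have "\<dots> = (\<Sum>B\<in>band_mats n w. \<Sum>c\<in>(window_vecs n w b :: 'a vec set). F B)"
    by (simp only: sum.cartesian_product case_prod_unfold)
  finally show ?thesis
    by (simp add: sum_distrib_left)
qed

lemma set_col_mult_prefix_vec:
  fixes B :: "'a :: field mat"
  assumes B: "B \<in> carrier_mat n n" and v: "v \<in> prefix_vecs n b"
  shows "set_col b c B *\<^sub>v v = B *\<^sub>v v"
proof (rule eq_vecI)
  fix i assume "i < dim_vec (B *\<^sub>v v)"
  then show "(set_col b c B *\<^sub>v v) $ i = (B *\<^sub>v v) $ i"
    using B v by (auto simp: set_col_def scalar_prod_def prefix_vecs_def intro!: sum.cong)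
qed (use B in \<open>simp add: set_col_def\<close>)

lemma set_col_mult_unit_vec:
  fixes B :: "'a :: field mat"
  assumes B: "B \<in> carrier_mat n n" and b: "b < n" and c: "c \<in> carrier_vec n"
  shows "set_col b c B *\<^sub>v unit_vec n b = c"
  using assms by (intro eq_vecI) (auto simp: set_col_def)

text \<open>A relation among the columns before \<open>b\<close> does not involve column
  \<open>b\<close>, so it survives resampling.\<close>

lemma kernel_prefix_set_col:
  fixes B :: "'a :: field mat"
  assumes B: "B \<in> carrier_mat n n"
  shows "kernel_prefix b B \<subseteq> kernel_prefix (Suc b) (set_col b c B)"
proof
  fix v assume v: "v \<in> kernel_prefix b B"
  have "set_col b c B \<in> carrier_mat n n"
    using B by (simp add: set_col_def)
  with v B show "v \<in> kernel_prefix (Suc b) (set_col b c B)"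
    using set_col_mult_prefix_vec[OF B, of v b c]
    by (auto simp: kernel_prefix_def mat_kernel_def prefix_vecs_def)
qed

text \<open>If the new column is the combination \<open>B *\<^sub>v v\<close> of the preceding ones,
  then \<open>unit_vec n b - v\<close> is a new relation: its entry at \<open>b\<close> is
  1.\<close>

lemma card_kernel_prefix_set_col_less:
  fixes B :: "'a :: {field, finite} mat"
  assumes B: "B \<in> carrier_mat n n" and b: "b < n" and v: "v \<in> prefix_vecs n b"
  shows "card (kernel_prefix b B) < card (kernel_prefix (Suc b) (set_col b (B *\<^sub>v v) B))"
proof (intro psubset_card_mono psubsetI notI)
  let ?B = "set_col b (B *\<^sub>v v) B"
  let ?u = "unit_vec n b - v"
  have Bc: "?B \<in> carrier_mat n n" and vc: "v \<in> carrier_vec n" and c: "B *\<^sub>v v \<in> carrier_vec n"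
    using B v by (auto simp: set_col_def prefix_vecs_def)
  have "?B *\<^sub>v ?u = B *\<^sub>v v - B *\<^sub>v v"
    using mult_minus_distrib_mat_vec[OF Bc _ vc, of "unit_vec n b"]
    by (simp add: set_col_mult_unit_vec[OF B b c] set_col_mult_prefix_vec[OF B v])
  then have "?u \<in> kernel_prefix (Suc b) ?B"
    using Bc vc v c by (auto simp: kernel_prefix_def mat_kernel[OF Bc] prefix_vecs_def)
  moreover have "?u \<notin> kernel_prefix b B"
  proof -
    have "?u $ b = 1"
      using b v by (auto simp: prefix_vecs_def)
    then show ?thesis
      using b B by (auto simp: kernel_prefix_def prefix_vecs_def)
  qed
  moreover assume "kernel_prefix b B = kernel_prefix (Suc b) ?B"
  ultimately show False
    by blast
qed (use kernel_prefix_set_col[OF B] in auto)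

text \<open>Truncating at \<open>P\<close> keeps the probability of an increase at least \<open>1 / (P * q ^ (w + 1))\<close>
  until \<open>P\<close> is reached; an increase of the cardinality is an increase by at least 1.\<close>

lemma sum_min_card_kernel_prefix_step:
  fixes P :: nat
  assumes b: "b < n"
  shows "(\<Sum>B\<in>band_mats n w. min (card (kernel_prefix b (B :: 'a mat))) P) * (P * CARD('a) ^ (w + 1))
           + card {B \<in> band_mats n w. card (kernel_prefix b (B :: 'a mat)) < P}
         \<le> (\<Sum>B\<in>band_mats n w. min (card (kernel_prefix (Suc b) (B :: 'a :: {field, finite} mat))) P)
              * (P * CARD('a) ^ (w + 1))"
proof -
  let ?X = "band_mats n w :: 'a mat set" and ?W = "window_vecs n w b :: 'a vec set"
  let ?k = "\<lambda>b B. card (kernel_prefix b (B :: 'a mat))"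
  let ?c = "P * CARD('a) ^ (w + 1)"
  have finX: "finite ?X"
    by (rule finite_band_mats)
  have W: "card ?W > 0"
  proof -
    have "0\<^sub>v n \<in> ?W"
      by (auto simp: window_vecs_def)
    then show ?thesis
      by (simp add: card_gt_0_iff) blast
  qed
  \<comment> \<open>The gain for fixed \<open>B\<close>, averaged over the new column, with the
    denominators \<open>card ?W\<close> and \<open>?c\<close> cleared.\<close>
  have step: "card ?W * (min (?k b B) P * ?c + of_bool (?k b B < P))
          \<le> (\<Sum>c\<in>?W. min (?k (Suc b) (set_col b c B)) P) * ?c" if B: "B \<in> ?X" for B
  proof -
    have Bc: "B \<in> carrier_mat n n"
      using B by (simp add: band_mats_def)
    \<comment> \<open>The new columns in the span of the preceding ones; each of them raises the
      count by at least 1.\<close>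
    define G where "G = {c \<in> ?W. \<exists>v \<in> prefix_vecs n b. B *\<^sub>v v = c}"
    have G: "G \<subseteq> ?W"
      by (auto simp: G_def)
    show ?thesis
    proof (cases "?k b B < P")
      case True
      have "(\<Sum>c\<in>?W. ?k b B + of_bool (c \<in> G)) \<le> (\<Sum>c\<in>?W. min (?k (Suc b) (set_col b c B)) P)"
      proof (rule sum_mono)
        fix c assume "c \<in> ?W"
        show "?k b B + of_bool (c \<in> G) \<le> min (?k (Suc b) (set_col b c B)) P"
        proof (cases "c \<in> G")
          case True
          then show ?thesis
            using card_kernel_prefix_set_col_less[OF Bc b] \<open>?k b B < P\<close> by (auto simp: G_def Suc_le_eq)
        next
          case False
          then show ?thesis
            using card_mono[OF finite_kernel_prefix kernel_prefix_set_col[OF Bc]] \<open>?k b B < P\<close> by simp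
        qed
      qed
      also have "(\<Sum>c\<in>?W. ?k b B + of_bool (c \<in> G)) = card ?W * ?k b B + card G"
        using G by (simp add: sum.distrib Int_absorb1 Collect_conj_eq[symmetric] flip: Int_def)
      finally have 1: "(card ?W * ?k b B + card G) * ?c \<le> (\<Sum>c\<in>?W. min (?k (Suc b) (set_col b c B)) P) * ?c"
        by (rule mult_right_mono) simp
      have "card ?W \<le> card G * ?k b B * CARD('a) ^ (w + 1)"
        unfolding G_def by (rule card_window_vecs_in_span[OF B b])
      \<comment> \<open>Below the truncation level, \<open>P\<close> replaces the factor that
        depends on \<open>B\<close>.\<close>
      also have "\<dots> \<le> card G * P * CARD('a) ^ (w + 1)"
        using True by (intro mult_right_mono mult_left_mono) auto
      finally have 2: "card ?W \<le> card G * ?c"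
        by (simp only: mult.assoc)
      from 1 2 True show ?thesis
        by (simp add: algebra_simps)
    next
      case False
      \<comment> \<open>Once the count has reached \<open>P\<close>, the truncated count stays
        there.\<close>
      have "(\<Sum>c\<in>?W. P) \<le> (\<Sum>c\<in>?W. min (?k (Suc b) (set_col b c B)) P)"
      proof (rule sum_mono)
        fix c
        show "P \<le> min (?k (Suc b) (set_col b c B)) P"
          using card_mono[OF finite_kernel_prefix kernel_prefix_set_col[OF Bc, of b c]] False by simp
      qed
      then have "card ?W * P * ?c \<le> (\<Sum>c\<in>?W. min (?k (Suc b) (set_col b c B)) P) * ?c"
        by (intro mult_right_mono) auto
      then show ?thesis
        using False by (simp add: mult.assoc)
    qed
  qed
  have "card ?W * ((\<Sum>B\<in>?X. min (?k b B) P) * ?c + card {B \<in> ?X. ?k b B < P})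
      = (\<Sum>B\<in>?X. card ?W * (min (?k b B) P * ?c + of_bool (?k b B < P)))"
    using finX by (simp add: sum.distrib sum_distrib_left sum_distrib_right Int_def ring_distribs)
  also have "\<dots> \<le> (\<Sum>B\<in>?X. (\<Sum>c\<in>?W. min (?k (Suc b) (set_col b c B)) P) * ?c)"
    by (rule sum_mono) (rule step)
  also have "\<dots> = (\<Sum>B\<in>?X. \<Sum>c\<in>?W. min (?k (Suc b) (set_col b c B)) P) * ?c"
    by (simp only: sum_distrib_right)
  also have "\<dots> = card ?W * ((\<Sum>B\<in>?X. min (?k (Suc b) B) P) * ?c)"
    by (subst sum_set_col[OF b]) (simp only: mult.assoc)
  finally show ?thesis
    using W by simp
qed

text \<open>A kernel with fewer than \<open>P\<close> elements keeps every
  \<open>kernel_prefix\<close> below \<open>P\<close>, so such a matrix contributes to the gain in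
  each of the \<open>n\<close> steps. The truncated sum never exceeds \<open>P\<close> times the
  number of matrices.\<close>

lemma card_small_kernel_le:
  fixes P :: nat
  shows "n * card {B \<in> band_mats n w. card (mat_kernel (B :: 'a :: {field, finite} mat)) < P}
           \<le> P\<^sup>2 * CARD('a) ^ (w + 1) * card (band_mats n w :: 'a mat set)"
proof -
  let ?X = "band_mats n w :: 'a mat set"
  let ?k = "\<lambda>b B. card (kernel_prefix b (B :: 'a mat))"
  let ?c = "P * CARD('a) ^ (w + 1)"
  let ?small = "card {B \<in> ?X. card (mat_kernel B) < P}"
  have finX: "finite ?X"
    by (rule finite_band_mats)
  have small: "?small \<le> card {B \<in> ?X. ?k b B < P}" for b
  proof (rule card_mono)
    show "{B \<in> ?X. card (mat_kernel B) < P} \<subseteq> {B \<in> ?X. ?k b B < P}"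
    proof safe
      fix B :: "'a mat" assume "card (mat_kernel B) < P"
      moreover have "?k b B \<le> card (mat_kernel B)"
        by (rule card_mono) (auto simp: kernel_prefix_def mat_kernel_def)
      ultimately show "?k b B < P"
        by simp
    qed
  qed (use finX in simp)
  have "b * ?small \<le> (\<Sum>B\<in>?X. min (?k b B) P) * ?c" if "b \<le> n" for b
    using that
  proof (induction b)
    case (Suc b)
    then show ?case
      using sum_min_card_kernel_prefix_step[where b = b and n = n and w = w and P = P and ?'a = 'a] small[of b] by simp
  qed simp
  from this[of n] have "n * ?small \<le> (\<Sum>B\<in>?X. min (?k n B) P) * ?c"
    by simp
  also have "\<dots> \<le> (\<Sum>B\<in>?X. P) * ?c"
    by (intro mult_right_mono sum_mono) auto
  finally show ?thesis
    by (simp add: power2_eq_square mult_ac)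
qed

subsection \<open>Pairs of vectors with separated supports\<close>

text \<open>Functions that vanish from \<open>n\<close> on stand for vectors of length
  \<open>n\<close>, so a pair for a smaller \<open>n\<close> is literally a pair for a larger
  one.\<close>

definition separated_pairs :: "nat \<Rightarrow> nat \<Rightarrow> ((nat \<Rightarrow> 'a :: zero) \<times> (nat \<Rightarrow> 'a)) set" where
  "separated_pairs n w =
     {(u, v). (\<forall>i\<ge>n. u i = 0 \<and> v i = 0) \<and>
              (\<forall>i j. u i \<noteq> 0 \<longrightarrow> v j \<noteq> 0 \<longrightarrow> \<bar>int i - int j\<bar> > int w)}"

text \<open>The zero pair, and the pairs whose last nonzero entry belongs to the first
  component.\<close>

definition fst_last_pairs :: "nat \<Rightarrow> nat \<Rightarrow> ((nat \<Rightarrow> 'a :: zero) \<times> (nat \<Rightarrow> 'a)) set" where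
  "fst_last_pairs n w = {(u, v) \<in> separated_pairs n w. \<forall>j. v j \<noteq> 0 \<longrightarrow> (\<exists>i>j. u i \<noteq> 0)}"

lemma finite_separated_pairs [simp]:
  "finite (separated_pairs n w :: ((nat \<Rightarrow> 'a :: {zero, finite}) \<times> _) set)"
proof -
  let ?F = "{f. \<forall>i. (i \<in> {..<n} \<longrightarrow> f i \<in> (UNIV :: 'a set)) \<and> (i \<notin> {..<n} \<longrightarrow> f i = 0)}"
  have "finite ?F"
    by (rule finite_set_of_finite_funs) simp_all
  then have "finite (?F \<times> ?F)"
    by simp
  then show ?thesis
    by (rule finite_subset[rotated]) (auto simp: separated_pairs_def)
qed

lemma finite_fst_last_pairs [simp]:
  "finite (fst_last_pairs n w :: ((nat \<Rightarrow> 'a :: {zero, finite}) \<times> _) set)"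
  by (rule finite_subset[OF _ finite_separated_pairs[of n w]]) (auto simp: fst_last_pairs_def)

text \<open>The supports are disjoint, even for \<open>w = 0\<close>, so the last nonzero position
  belongs to exactly one component. If it is the second, swap.\<close>

lemma card_separated_pairs_le:
  "card (separated_pairs n w :: ((nat \<Rightarrow> 'a :: {zero, finite}) \<times> _) set)
     \<le> 2 * card (fst_last_pairs n w :: ((nat \<Rightarrow> 'a) \<times> _) set)"
proof -
  let ?A = "fst_last_pairs n w :: ((nat \<Rightarrow> 'a) \<times> _) set"
  have "separated_pairs n w \<subseteq> ?A \<union> prod.swap ` ?A"
  proof
    fix x :: "(nat \<Rightarrow> 'a) \<times> (nat \<Rightarrow> 'a)" assume x: "x \<in> separated_pairs n w"
    obtain u v where uv: "x = (u, v)"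
      by (cases x)
    let ?S = "{i. u i \<noteq> 0} \<union> {i. v i \<noteq> 0}"
    have "?S \<subseteq> {..<n}"
      using x by (auto simp: uv separated_pairs_def not_le[symmetric])
    then have fin: "finite ?S"
      by (rule finite_subset) simp
    have neq: "i \<noteq> j" if "u i \<noteq> 0" "v j \<noteq> 0" for i j
      using x that by (fastforce simp: uv separated_pairs_def)
    show "x \<in> ?A \<union> prod.swap ` ?A"
    proof (cases "?S = {}")
      case True
      then have "x \<in> ?A"
        using x by (auto simp: uv fst_last_pairs_def)
      then show ?thesis ..
    next
      case False
      define m where "m = Max ?S"
      have m: "m \<in> ?S" and le: "\<And>i. i \<in> ?S \<Longrightarrow> i \<le> m"
        using Max_in[OF fin False] Max_ge[OF fin] by (simp_all only: m_def)
      from m consider "u m \<noteq> 0" | "v m \<noteq> 0"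
        by blast
      then show ?thesis
      proof cases
        case 1
        have "m > j" if "v j \<noteq> 0" for j
          using le[of j] neq[OF 1 that] that by simp
        with 1 x have "x \<in> ?A"
          by (auto simp: uv fst_last_pairs_def)
        then show ?thesis ..
      next
        case 2
        have "m > i" if "u i \<noteq> 0" for i
          using le[of i] neq[OF that 2] that by simp
        with 2 x have "(v, u) \<in> ?A"
          by (fastforce simp: uv fst_last_pairs_def separated_pairs_def)
        then show ?thesis
          by (force simp: uv)
      qed
    qed
  qed
  then have "card (separated_pairs n w :: ((nat \<Rightarrow> 'a) \<times> _) set) \<le> card (?A \<union> prod.swap ` ?A)"
    by (intro card_mono) auto
  also have "\<dots> \<le> card ?A + card (prod.swap ` ?A)"
    by (rule card_Un_le)
  also have "\<dots> \<le> 2 * card ?A"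
    using card_image_le[of ?A prod.swap] by simp
  finally show ?thesis .
qed

lemma fst_last_pairs_0: "fst_last_pairs 0 w = {(\<lambda>_. 0, \<lambda>_. 0)}"
  by (auto simp: fst_last_pairs_def separated_pairs_def fun_eq_iff)

text \<open>If removing the last nonzero entry of \<open>u\<close> makes the last nonzero entry belong to \<open>v\<close>,
  then the \<open>w\<close> positions before it are empty.\<close>

lemma card_fst_last_pairs_Suc:
  "card (fst_last_pairs (Suc n) w :: ((nat \<Rightarrow> 'a :: {zero, finite}) \<times> _) set)
     \<le> CARD('a) * card (fst_last_pairs n w :: ((nat \<Rightarrow> 'a) \<times> _) set)
       + (if w \<le> n then CARD('a) * card (fst_last_pairs (n - w) w :: ((nat \<Rightarrow> 'a) \<times> _) set) else 0)"
proof -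
  let ?A = "\<lambda>n. fst_last_pairs n w :: ((nat \<Rightarrow> 'a) \<times> _) set"
  let ?f = "\<lambda>(a :: 'a, (u, v)). (u(n := a), v)" and ?g = "\<lambda>(a :: 'a, (v, u)). (u(n := a), v)"
  \<comment> \<open>For \<open>w > n\<close> the truncated difference \<open>n - w\<close> is 0,
    where the zero pair would still be counted; the empty set avoids this.\<close>
  let ?A' = "if w \<le> n then ?A (n - w) else {}"
  have "?A (Suc n) \<subseteq> ?f ` (UNIV \<times> ?A n) \<union> ?g ` (UNIV \<times> ?A')"
  proof
    fix x assume x: "x \<in> ?A (Suc n)"
    obtain u v where uv: "x = (u, v)"
      by (cases x)
    have supp: "u i = 0" "v i = 0" if "i > n" for i
      using x that by (auto simp: uv fst_last_pairs_def separated_pairs_def)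
    have sep: "\<bar>int i - int j\<bar> > int w" if "u i \<noteq> 0" "v j \<noteq> 0" for i j
      using x that by (auto simp: uv fst_last_pairs_def separated_pairs_def)
    have last: "\<exists>i>j. u i \<noteq> 0" if "v j \<noteq> 0" for j
      using x that by (auto simp: uv fst_last_pairs_def)
    have vn: "v n = 0"
      using last[of n] supp by auto
    define u' where "u' = u(n := 0)"
    have supp': "u' i = 0" "v i = 0" if "i \<ge> n" for i
      using supp[of i] that vn by (auto simp: u'_def le_less)
    have sep': "\<bar>int i - int j\<bar> > int w" if "u' i \<noteq> 0" "v j \<noteq> 0" for i j
      using sep that by (auto simp: u'_def split: if_splits)
    have u: "u = u'(n := u n)"
      by (simp add: u'_def)
    show "x \<in> ?f ` (UNIV \<times> ?A n) \<union> ?g ` (UNIV \<times> ?A')"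
    proof (cases "(u', v) \<in> ?A n")
      case True
      then have "?f (u n, (u', v)) \<in> ?f ` (UNIV \<times> ?A n)"
        by blast
      then show ?thesis
        using u by (simp add: uv)
    next
      case False
      \<comment> \<open>Beyond \<open>j0\<close> the function \<open>u'\<close> vanishes, so the
        nonzero entry of \<open>u\<close> after \<open>j0\<close> can only be
        \<open>u n\<close>.\<close>
      then obtain j0 where j0: "v j0 \<noteq> 0" "\<And>i. i > j0 \<Longrightarrow> u' i = 0"
        using supp' sep' by (auto simp: fst_last_pairs_def separated_pairs_def)
      have un: "u n \<noteq> 0"
        using last[OF j0(1)] j0(2) by (metis u'_def fun_upd_other)
      have v: "j + w < n" if "v j \<noteq> 0" for j
        using sep[OF un that] supp(2)[of j] that by (cases "j \<le> n") auto
      have u'j: "i < j0" if "u' i \<noteq> 0" for i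
        using j0(2)[of i] sep'[OF that j0(1)] that by (metis abs_zero cancel_comm_monoid_add_class.diff_cancel linorder_neqE_nat of_nat_less_0_iff)
      have "w \<le> n"
        using v[OF j0(1)] by simp
      \<comment> \<open>The last nonzero entry now belongs to \<open>v\<close>, so the components
        change roles; \<open>?g\<close> swaps them back.\<close>
      moreover have "(v, u') \<in> ?A (n - w)"
      proof -
        have "v i = 0 \<and> u' i = 0" if "i \<ge> n - w" for i
          using v[of i] u'j[of i] v[OF j0(1)] that by force
        moreover have "\<bar>int i - int j\<bar> > int w" if "v i \<noteq> 0" "u' j \<noteq> 0" for i j
          using sep'[OF that(2,1)] by simp
        ultimately show ?thesis
          using u'j j0(1) by (simp add: fst_last_pairs_def separated_pairs_def) blast
      qed
      ultimately have "(u n, (v, u')) \<in> UNIV \<times> ?A'"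
        by simp
      then have "?g (u n, (v, u')) \<in> ?g ` (UNIV \<times> ?A')"
        by (rule imageI)
      then show ?thesis
        using u by (simp add: uv)
    qed
  qed
  then have "card (?A (Suc n)) \<le> card (?f ` (UNIV \<times> ?A n) \<union> ?g ` (UNIV \<times> ?A'))"
    by (intro card_mono) auto
  also have "\<dots> \<le> card (?f ` (UNIV \<times> ?A n)) + card (?g ` (UNIV \<times> ?A'))"
    by (rule card_Un_le)
  also have "\<dots> \<le> card ((UNIV :: 'a set) \<times> ?A n) + card ((UNIV :: 'a set) \<times> ?A')"
    by (intro add_mono card_image_le) auto
  finally show ?thesis
    by (auto simp: card_cartesian_product)
qed

text \<open>The recursion reaches back to \<open>n - w\<close>, hence the strong induction. A
  geometric bound with ratio \<open>?c\<close> propagates because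
  \<open>?q * (?c ^ m + ?c ^ m / ?q ^ w) = ?c ^ Suc m\<close>.\<close>

lemma card_fst_last_pairs_le:
  "real (card (fst_last_pairs n w :: ((nat \<Rightarrow> 'a :: {zero, finite}) \<times> _) set))
     \<le> (CARD('a) * (1 + 1 / CARD('a) ^ w)) ^ n"
proof (induction n rule: less_induct)
  case (less n)
  let ?A = "\<lambda>n. fst_last_pairs n w :: ((nat \<Rightarrow> 'a) \<times> _) set"
  let ?q = "real CARD('a)"
  let ?c = "?q * (1 + 1 / ?q ^ w)"
  have q: "?q > 0"
    by simp
  have c: "?q \<le> ?c" "?c > 0"
    using q by (simp_all add: add_pos_nonneg)
  show ?case
  proof (cases n)
    case 0
    then show ?thesis
      by (simp add: fst_last_pairs_0)
  next
    case (Suc m)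
    have "(if w \<le> m then ?q * card (?A (m - w)) else 0) \<le> ?q * (?c ^ m / ?q ^ w)"
    proof (cases "w \<le> m")
      case True
      \<comment> \<open>Since \<open>?q \<le> ?c\<close>, the \<open>w\<close> missing factors
        \<open>?c\<close> yield the factor \<open>1 / ?q ^ w\<close>.\<close>
      have "card (?A (m - w)) * ?q ^ w \<le> ?c ^ (m - w) * ?c ^ w"
        using less.IH[of "m - w"] Suc c q by (intro mult_mono power_mono) auto
      also have "\<dots> = ?c ^ m"
        using True by (simp flip: power_add)
      finally show ?thesis
        using True q by (simp add: pos_le_divide_eq)
    qed (use c q in simp)
    moreover have "real (card (?A (Suc m)))
        \<le> ?q * card (?A m) + (if w \<le> m then ?q * card (?A (m - w)) else 0)"
      using of_nat_mono[where ?'a = real, OF card_fst_last_pairs_Suc[where n = m and w = w and ?'a = 'a]]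
      by (simp split: if_splits)
    moreover have "?q * card (?A m) \<le> ?q * ?c ^ m"
      using less.IH[of m] Suc by (intro mult_left_mono) auto
    ultimately have "real (card (?A (Suc m))) \<le> ?q * ?c ^ m + ?q * (?c ^ m / ?q ^ w)"
      by linarith
    also have "\<dots> = ?c ^ Suc m"
      by (simp add: algebra_simps)
    finally show ?thesis
      by (simp add: Suc)
  qed
qed

lemma card_separated_pairs_le_exp:
  "real (card (separated_pairs n w :: ((nat \<Rightarrow> 'a :: {zero, finite}) \<times> _) set))
     \<le> 2 * CARD('a) ^ n * exp (n / CARD('a) ^ w)"
proof -
  let ?q = "real CARD('a)"
  have "real (card (separated_pairs n w :: ((nat \<Rightarrow> 'a) \<times> _) set))
      \<le> 2 * (?q * (1 + 1 / ?q ^ w)) ^ n"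
    using of_nat_mono[where ?'a = real, OF card_separated_pairs_le[where n = n and w = w and ?'a = 'a]]
      card_fst_last_pairs_le[where n = n and w = w and ?'a = 'a] by simp
  also have "\<dots> = 2 * ?q ^ n * (1 + 1 / ?q ^ w) ^ n"
    by (simp add: power_mult_distrib)
  also have "\<dots> \<le> 2 * ?q ^ n * exp (1 / ?q ^ w) ^ n"
    by (intro mult_left_mono power_mono exp_ge_add_one_self) (auto intro: add_nonneg_nonneg)
  finally show ?thesis
    by (simp flip: exp_of_nat_mult)
qed

text \<open>For fixed \<open>v\<close>, the rows whose window misses the support of \<open>v\<close> impose no condition in
  \<open>B v = 0\<close>. A vector \<open>y\<close> splits into its part on these rows, which is separated from \<open>v\<close>, and its
  part on the remaining rows, which is recorded in \<open>B\<close> by making it the value of \<open>B v\<close>.\<close>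

lemma sum_card_mat_kernel_le:
  "(\<Sum>B\<in>band_mats n w. card (mat_kernel (B :: 'a :: {field, finite} mat))) * CARD('a) ^ n
     \<le> card (band_mats n w :: 'a mat set)
        * card (separated_pairs n w :: ((nat \<Rightarrow> 'a) \<times> (nat \<Rightarrow> 'a)) set)"
proof -
  let ?X = "band_mats n w :: 'a mat set"
  let ?D = "Sigma ?X mat_kernel \<times> (carrier_vec n :: 'a vec set)"
  define hit where "hit v i j \<longleftrightarrow> j < n \<and> \<bar>int i - int j\<bar> \<le> int w \<and> v $ j \<noteq> 0" for v :: "'a vec" and i j
  define act where "act v i \<longleftrightarrow> (\<exists>j. hit v i j)" for v i
  define wit where "wit v i = (SOME j. hit v i j)" for v i
  have wit: "hit v i (wit v i)" if "act v i" for v i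
    using that unfolding act_def wit_def by (rule someI_ex)
  \<comment> \<open>In an active row, adding \<open>y $ i / v $ j\<close> at one band entry with
    \<open>v $ j \<noteq> 0\<close> moves entry \<open>i\<close> of the product with
    \<open>v\<close> from 0 to \<open>y $ i\<close>.\<close>
  define M where "M B v y = mat n n (\<lambda>(i, j). B $$ (i, j) +
      (if act v i \<and> j = wit v i then y $ i / v $ j else 0))" for B :: "'a mat" and v y :: "'a vec"
  define g where "g = (\<lambda>((B, v), y). (M B v y,
      (\<lambda>i. if i < n \<and> \<not> act v i then y $ i else 0), (\<lambda>i. if i < n then v $ i else 0)))"
  have finX: "finite ?X"
    by (rule finite_band_mats)
  have ker: "mat_kernel B \<subseteq> carrier_vec n" if "B \<in> ?X" for B
    using that by (auto simp: band_mats_def mat_kernel_def)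
  have finker: "finite (mat_kernel B)" if "B \<in> ?X" for B
    by (rule finite_subset[OF ker[OF that]]) simp
  have Mv: "(M B v y *\<^sub>v v) $ i = (if act v i then y $ i else 0)"
    if B: "B \<in> ?X" and v: "v \<in> mat_kernel B" and i: "i < n" for B v y i
  proof -
    have Bc: "B \<in> carrier_mat n n" and vc: "v \<in> carrier_vec n"
      using B ker[OF B] v by (auto simp: band_mats_def)
    have "(B *\<^sub>v v) $ i = 0"
      using v i by (simp add: mat_kernel[OF Bc])
    then have 0: "(\<Sum>j<n. B $$ (i, j) * v $ j) = 0"
      using i Bc vc by (simp add: scalar_prod_def atLeast0LessThan)
    have "(M B v y *\<^sub>v v) $ i = (\<Sum>j<n. (B $$ (i, j) +
            (if act v i \<and> j = wit v i then y $ i / v $ j else 0)) * v $ j)"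
      using i vc by (simp add: M_def scalar_prod_def atLeast0LessThan)
    also have "\<dots> = (\<Sum>j<n. B $$ (i, j) * v $ j)
        + (\<Sum>j<n. if j = wit v i then (if act v i then y $ i / v $ j * v $ j else 0) else 0)"
      unfolding sum.distrib[symmetric] by (rule sum.cong) (auto simp: algebra_simps)
    also have "\<dots> = (if act v i then y $ i else 0)"
      using 0 wit[of v i] by (auto simp: hit_def)
    finally show ?thesis .
  qed
  \<comment> \<open>The last component gives \<open>v\<close>. Then \<open>y\<close> is read off
    \<open>M B v y *\<^sub>v v\<close> on active rows and off the middle component elsewhere. As
    \<open>wit\<close> depends only on \<open>v\<close>, the change to \<open>B\<close> can be
    undone.\<close>
  have "inj_on g ?D"
  proof (rule inj_onI)
    fix x x' assume "x \<in> ?D" "x' \<in> ?D" and e: "g x = g x'"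
    then obtain B v y B' v' y' where x: "x = ((B, v), y)" "x' = ((B', v'), y')"
      and m: "B \<in> ?X" "v \<in> mat_kernel B" "y \<in> carrier_vec n"
        "B' \<in> ?X" "v' \<in> mat_kernel B'" "y' \<in> carrier_vec n"
      by (cases x, cases x') auto
    have carr: "v \<in> carrier_vec n" "v' \<in> carrier_vec n" "B \<in> carrier_mat n n" "B' \<in> carrier_mat n n"
      using m ker by (auto simp: band_mats_def)
    have eqs: "M B v y = M B' v' y'"
      "\<And>i. (if i < n \<and> \<not> act v i then y $ i else 0) = (if i < n \<and> \<not> act v' i then y' $ i else 0)"
      "\<And>i. (if i < n then v $ i else 0) = (if i < n then v' $ i else 0)"
      using e by (auto simp: g_def x fun_eq_iff)
    have v: "v' = v"
    proof (rule eq_vecI)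
      fix i assume "i < dim_vec v"
      then show "v' $ i = v $ i"
        using eqs(3)[of i] carr by simp
    qed (use carr in simp)
    have y: "y' = y"
    proof (rule eq_vecI)
      fix i assume "i < dim_vec y"
      then have i: "i < n"
        using m by simp
      show "y' $ i = y $ i"
        using Mv[OF m(1,2) i, of y] Mv[OF m(4,5) i, of y'] eqs(1) eqs(2)[of i] i
        by (auto simp: v split: if_splits)
    qed (use m in simp)
    have B: "B' = B"
    proof (rule eq_matI)
      fix i j assume "i < dim_row B" "j < dim_col B"
      then show "B' $$ (i, j) = B $$ (i, j)"
        using arg_cong[OF eqs(1), of "\<lambda>X. X $$ (i, j)"] carr by (simp add: M_def v y)
    qed (use carr in auto)
    show "x = x'"
      by (simp add: x v y B)
  qed
  moreover have "g ` ?D \<subseteq> ?X \<times> separated_pairs n w"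
  proof (rule image_subsetI)
    fix x assume "x \<in> ?D"
    then obtain B v y where x: "x = ((B, v), y)"
      and m: "B \<in> ?X" "v \<in> mat_kernel B" "y \<in> carrier_vec n"
      by (cases x) auto
    have "M B v y \<in> ?X"
      using m wit[of v] by (fastforce simp: band_mats_def M_def hit_def)
    moreover have "(\<lambda>i. if i < n \<and> \<not> act v i then y $ i else 0, \<lambda>i. if i < n then v $ i else 0)
        \<in> separated_pairs n w"
      by (auto simp: separated_pairs_def act_def hit_def simp flip: not_le split: if_splits)
    ultimately show "g x \<in> ?X \<times> separated_pairs n w"
      by (simp add: x g_def)
  qed
  ultimately have "card ?D \<le> card (?X \<times> (separated_pairs n w :: ((nat \<Rightarrow> 'a) \<times> (nat \<Rightarrow> 'a)) set))"
    by (rule card_inj_on_le) (simp add: finX)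
  then show ?thesis
    using finX finker by (simp add: card_cartesian_product card_SigmaI card_carrier_vec)
qed

section \<open>Tail bounds for the kernel dimension\<close>

text \<open>Markov's inequality for the size of the kernel, which is exponential in its
  dimension.\<close>

lemma card_kernel_dim_ge_le:
  "real (card {B \<in> band_mats n w. K \<le> kernel_dim (B :: 'a :: {field, finite} mat)}) * CARD('a) ^ K
     \<le> 2 * exp (n / CARD('a) ^ w) * card (band_mats n w :: 'a mat set)"
proof -
  let ?X = "band_mats n w :: 'a mat set" and ?q = "CARD('a)"
  let ?S = "\<Sum>B\<in>?X. card (mat_kernel B)"
  have finX: "finite ?X"
    by (rule finite_band_mats)
  have "card {B \<in> ?X. K \<le> kernel_dim B} * ?q ^ K = (\<Sum>B | B \<in> ?X \<and> K \<le> kernel_dim B. ?q ^ K)"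
    by simp
  also have "\<dots> \<le> (\<Sum>B | B \<in> ?X \<and> K \<le> kernel_dim B. card (mat_kernel B))"
  proof (rule sum_mono)
    fix B assume "B \<in> {B \<in> ?X. K \<le> kernel_dim B}"
    then have "B \<in> carrier_mat n n" "K \<le> kernel_dim B"
      by (auto simp: band_mats_def)
    then show "?q ^ K \<le> card (mat_kernel B)"
      by (simp add: card_mat_kernel power_increasing)
  qed
  also have "\<dots> \<le> ?S"
    using finX by (intro sum_mono2) auto
  finally have 1: "real (card {B \<in> ?X. K \<le> kernel_dim B}) * ?q ^ K \<le> real ?S"
    by (simp only: of_nat_mult[symmetric] of_nat_le_iff)
  have "real ?S * ?q ^ n \<le> card ?X * real (card (separated_pairs n w :: ((nat \<Rightarrow> 'a) \<times> (nat \<Rightarrow> 'a)) set))"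
    using of_nat_mono[where ?'a = real, OF sum_card_mat_kernel_le[where n = n and w = w and ?'a = 'a]]
    by simp
  also have "\<dots> \<le> card ?X * (2 * ?q ^ n * exp (n / ?q ^ w))"
    by (intro mult_left_mono card_separated_pairs_le_exp) simp
  finally have "real ?S * ?q ^ n \<le> (2 * exp (n / ?q ^ w) * card ?X) * ?q ^ n"
    by (simp only: mult_ac)
  then have "real ?S \<le> 2 * exp (n / ?q ^ w) * card ?X"
    by (rule mult_right_le_imp_le) simp
  with 1 show ?thesis
    by (rule order_trans)
qed

text \<open>Dimension below \<open>K\<close> means fewer than \<open>P = CARD('a) ^ K\<close> kernel
  vectors; the square of \<open>P\<close> gives the \<open>2 * K\<close> in the exponent.\<close>

lemma card_kernel_dim_less_le:
  "n * card {B \<in> band_mats n w. kernel_dim (B :: 'a :: {field, finite} mat) < K}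
     \<le> CARD('a) ^ (2 * K + w + 1) * card (band_mats n w :: 'a mat set)"
proof -
  have "card (UNIV :: 'a set) > 1"
    using card_mono[of "UNIV :: 'a set" "{0, 1}"] by simp
  then have "{B \<in> band_mats n w. kernel_dim (B :: 'a mat) < K}
      = {B \<in> band_mats n w. card (mat_kernel B) < CARD('a) ^ K}"
    by (auto simp: band_mats_def card_mat_kernel)
  then show ?thesis
    using card_small_kernel_le[of n w "CARD('a) ^ K", where ?'a = 'a]
    by (simp add: power_add power_mult[symmetric] mult.commute mult.assoc)
qed

subsection \<open>Tightness\<close>

lemma measure_kernel_dim_law:
  fixes a b :: real
  shows "measure (kernel_dim_law (random_band_mat n w :: 'p :: prime_card mod_ring mat pmf)) {a<..b}
     = card {B \<in> band_mats n w :: 'p mod_ring mat set. a < real (kernel_dim B) \<and> real (kernel_dim B) \<le> b}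
       / card (band_mats n w :: 'p mod_ring mat set)"
proof -
  let ?X = "band_mats n w :: 'p mod_ring mat set"
  let ?P = "random_band_mat n w :: 'p mod_ring mat pmf"
  have "measure (kernel_dim_law ?P) {a<..b}
      = measure ?P {B. a < real (kernel_dim B) \<and> real (kernel_dim B) \<le> b}"
    by (simp add: kernel_dim_law_def measure_distr vimage_def)
  also have "\<dots> = card (?X \<inter> {B. a < real (kernel_dim B) \<and> real (kernel_dim B) \<le> b}) / card ?X"
    unfolding random_band_mat_def
    by (rule measure_pmf_of_set[OF band_mats_nonempty finite_band_mats])
  finally show ?thesis
    by (simp add: Int_def)
qed

lemma real_distribution_kernel_dim_law: "real_distribution (kernel_dim_law P)"
  unfolding kernel_dim_law_def by (rule prob_space.real_distribution_distr[OF prob_space_measure_pmf]) simp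

lemma card_band_mats_pos: "card (band_mats n w :: 'a :: {zero, finite} mat set) > 0"
  using band_mats_nonempty[of n w] finite_band_mats[of n w] by (simp add: card_gt_0_iff)

text \<open>The shift by \<open>Suc\<close> starts the sequence of laws at index 1. The value of the
  other sequence at 0 does not affect the \<open>liminf\<close>.\<close>

theorem theorem5:
  fixes w :: "nat \<Rightarrow> nat"
  assumes "\<forall>n\<ge>1. w n > 0"
  shows "tight (\<lambda>n. kernel_dim_law
             (random_band_mat (Suc n) (w (Suc n)) :: 'p :: prime_card mod_ring mat pmf))
         \<longleftrightarrow> liminf (\<lambda>n. ereal (real (w n) - log (real CARD('p)) (real n))) > -\<infinity>"
    (is "tight ?\<mu> \<longleftrightarrow> liminf ?f > -\<infinity>")
proof -
  let ?X = "\<lambda>n. band_mats (Suc n) (w (Suc n)) :: 'p mod_ring mat set"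
  let ?p = "real CARD('p)"
  have p: "?p > 1"
    using prime_gt_1_nat[OF prime_card] by simp
  have X: "card (?X n) > 0" for n
    by (rule card_band_mats_pos)
  show ?thesis
  proof
    assume "tight ?\<mu>"
    then have "\<forall>\<epsilon>>0. \<exists>a b. a < b \<and> (\<forall>n. 1 - \<epsilon> < measure (?\<mu> n) {a<..b})"
      by (simp add: tight_def)
    from this[rule_format, of "1 / 2"]
    obtain a b where ab: "\<And>n. measure (?\<mu> n) {a<..b} > 1 - 1 / 2"
      by auto
    \<comment> \<open>For every index, more than half of the matrices have kernel dimension at most
      \<open>b\<close>, hence less than \<open>K\<close>.\<close>
    define K where "K = nat \<lceil>b\<rceil> + 1"
    \<comment> \<open>The base-\<open>?p\<close> logarithm of
      \<open>n \<le> 2 * ?p ^ (2 * K + w n + 1)\<close>, derived below, gives this constant.\<close>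
    define C where "C = - (log ?p 2 + (2 * K + 1))"
    have "C \<le> w n - log ?p n" if "n \<ge> 1" for n
    proof -
      obtain m where m: "n = Suc m"
        using \<open>n \<ge> 1\<close> by (cases n) auto
      let ?B = "{B \<in> ?X m. kernel_dim B < K}"
      have "card {B \<in> ?X m. a < real (kernel_dim B) \<and> real (kernel_dim B) \<le> b} \<le> card ?B"
        by (intro card_mono) (auto simp: finite_band_mats K_def, linarith)
      moreover have "card (?X m) < 2 * real (card {B \<in> ?X m. a < real (kernel_dim B) \<and> real (kernel_dim B) \<le> b})"
        using ab[of m] X[of m] by (simp add: measure_kernel_dim_law pos_less_divide_eq)
      ultimately have "card (?X m) \<le> 2 * card ?B"
        by linarith
      then have "n * card (?X m) \<le> 2 * (n * card ?B)"
        by simp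
      also have "\<dots> \<le> 2 * (CARD('p) ^ (2 * K + w n + 1) * card (?X m))"
        using card_kernel_dim_less_le[where n = n and w = "w n" and K = K and ?'a = "'p mod_ring"]
        by (simp add: m)
      finally have "n \<le> 2 * CARD('p) ^ (2 * K + w n + 1)"
        using X[of m] by (simp only: mult.assoc[symmetric] mult_le_cancel2)
      then have "real n \<le> 2 * ?p ^ (2 * K + w n + 1)"
        by (metis of_nat_le_iff of_nat_mult of_nat_numeral of_nat_power)
      then have "log ?p n \<le> log ?p (2 * ?p ^ (2 * K + w n + 1))"
        using p \<open>n \<ge> 1\<close> by (intro log_mono) auto
      also have "\<dots> = log ?p 2 + (2 * K + w n + 1)"
        using p by (simp add: log_mult log_nat_power)
      finally show ?thesis
        by (simp add: C_def)
    qed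
    then have "eventually (\<lambda>n. ereal C \<le> ?f n) sequentially"
      by (auto simp: eventually_sequentially)
    then have "ereal C \<le> liminf ?f"
      by (rule Liminf_bounded)
    then show "liminf ?f > -\<infinity>"
      by (rule less_le_trans[rotated]) simp
  next
    assume "liminf ?f > -\<infinity>"
    then obtain C where "ereal C < liminf ?f"
      using ereal_dense2 by blast
    from less_LiminfD[OF this] obtain n0 where n0: "\<And>n. n \<ge> n0 \<Longrightarrow> C < w n - log ?p n"
      by (auto simp: eventually_sequentially)
    \<comment> \<open>From \<open>n0\<close> on, the bound on \<open>w n\<close> gives
      \<open>?p powr (- C)\<close>; for the finitely many earlier \<open>n\<close> the quotient is
      at most \<open>n < n0\<close>.\<close>
    define M where "M = max (?p powr (- C)) n0"
    have M: "n / ?p ^ w n \<le> M" if "n \<ge> 1" for n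
    proof (cases "n \<ge> n0")
      case True
      have "real n = ?p powr log ?p n"
        using p that by simp
      also have "\<dots> \<le> ?p powr (w n - C)"
        using n0[OF True] p by (intro powr_mono) auto
      also have "\<dots> = ?p powr (- C) * ?p ^ w n"
        using p by (simp add: powr_diff powr_minus powr_realpow divide_simps)
      finally have "n / ?p ^ w n \<le> ?p powr (- C)"
        using p by (simp add: pos_divide_le_eq)
      then show ?thesis
        by (simp add: M_def)
    next
      case False
      have "n / ?p ^ w n \<le> n / 1"
        using p by (intro divide_left_mono) auto
      then show ?thesis
        using False by (simp add: M_def)
    qed
    show "tight ?\<mu>"
      unfolding tight_def
    proof (intro conjI allI impI)
      fix \<epsilon> :: real assume "\<epsilon> > 0"
      \<comment> \<open>This makes the Markov bound \<open>2 * exp M / ?p ^ K\<close> on the tail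
        smaller than \<open>\<epsilon>\<close>.\<close>
      obtain K where K: "2 * exp M / \<epsilon> < ?p ^ K"
        using real_arch_pow[OF p] by blast
      show "\<exists>a b. a < b \<and> (\<forall>n. 1 - \<epsilon> < measure (?\<mu> n) {a<..b})"
      proof (intro exI conjI allI)
        \<comment> \<open>The interval is open on the left, so the endpoint -1 keeps dimension 0
          inside.\<close>
        show "- 1 < real K"
          by simp
        fix n
        let ?G = "{B \<in> ?X n. K \<le> kernel_dim B}" and ?H = "{B \<in> ?X n. -1 < real (kernel_dim B) \<and> real (kernel_dim B) \<le> K}"
        have "card (?X n) \<le> card (?G \<union> ?H)"
          by (intro card_mono) (auto simp: finite_band_mats)
        also have "\<dots> \<le> card ?G + card ?H"
          by (rule card_Un_le)
        finally have GH: "real (card (?X n)) \<le> card ?G + card ?H"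
          by linarith
        have "card ?G * ?p ^ K \<le> 2 * exp (Suc n / ?p ^ w (Suc n)) * card (?X n)"
          using card_kernel_dim_ge_le[where n = "Suc n" and w = "w (Suc n)" and K = K and ?'a = "'p mod_ring"]
          by simp
        also have "\<dots> \<le> 2 * exp M * card (?X n)"
          using M[of "Suc n"] by (intro mult_right_mono mult_left_mono) auto
        also have "\<dots> < \<epsilon> * ?p ^ K * card (?X n)"
          using K X[of n] \<open>\<epsilon> > 0\<close> by (simp add: pos_divide_less_eq mult.commute)
        also have "\<dots> = \<epsilon> * card (?X n) * ?p ^ K"
          by simp
        finally have "card ?G < \<epsilon> * card (?X n)"
          using p by (simp add: mult_less_cancel_right)
        with GH have "(1 - \<epsilon>) * card (?X n) < card ?H"
          by (simp add: algebra_simps)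
        then show "1 - \<epsilon> < measure (?\<mu> n) {- 1<..real K}"
          using X[of n] by (simp add: measure_kernel_dim_law pos_less_divide_eq)
      qed
    qed (rule real_distribution_kernel_dim_law)
  qed
qed

end
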